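(* Let $p,q\geq 2$ be integers and let $G$ be a finite semiregular simple graph with edge degree $p+q$, that is, a finite connected bipartite simple graph in which every edge connects a vertex of degree $p+1$ to a vertex of degree $q+1$. Then there exist a constant $C_G>0$ and a number $\beta\in[(pq)^{-1/4},1)$, both depending only on $G$, such that for every function $f:E\to\mathbb{R}$ on the edges of $G$, every basepoint $v_0\in\widetilde{V}$ and every integer $r\geq 0$, $$\Big|M_{r,v_0}(f)-\frac{1}{|E|}\sum_{e\in E}f(e)\Big|\leq C_G\,\|f\|_2\,\beta^r .$$ In particular $C_G$ is independent of $v_0$.
   Context: $G$ is a graph with vertex set $V$ and edge set $E$; it is simple if it has no loops and no multiple edges. The edge degree of $e$ is the number of edges (other than $e$) meeting $e$ in either of its endpoints. A semiregular graph is a connected bipartite graph in which every edge connects a vertex of degree $p+1$ to one of degree $q+1$ (so that the edge degree is constant, equal to $p+q$). The universal cover $\widetilde{G}$ of $G$ is the tree, with vertex set $\widetilde{V}$ and edge set $\widetilde{E}$, whose vertices are the non-backtracking paths in $G$ starting at a fixed root vertex, two such paths being neighbours if they differ by exactly one edge at the end. The projection $\pi:\widetilde{G}\to G$ sends a path to its terminal vertex, and an edge of $\widetilde{G}$ to the edge of $G$ by which the two paths differ. The lift of $f:E\to\mathbb{R}$ is $\tilde f=f\circ\pi:\widetilde{E}\to\mathbb{R}$. With $\delta$ the combinatorial distance between vertices of $\widetilde{G}$, the edge sphere is $$S'_r(v_0)=\{e=\{x,y\}\in\widetilde{E}:\min\{\delta(x,v_0),\delta(y,v_0)\}=r\},$$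 and the spherical mean is $$M_{r,v_0}(f)=\frac{1}{|S'_r(v_0)|}\sum_{e\in S'_r(v_0)}\tilde f(e).$$ The norm is $\|f\|_2=\big(\sum_{e\in E}f(e)^2\big)^{1/2}$. *)

theory Defs
  imports Complex_Main "HOL-Analysis.L2_Norm"
begin

text \<open>
  A simple graph is given by a vertex set \<open>V\<close> and a set \<open>E\<close> of two-element subsets of \<open>V\<close>.
  There are no multiple edges, so a path is determined by its list of successive vertices;
  a list with \<open>n + 1\<close> entries is a path with \<open>n\<close> edges.
\<close>

definition simple_graph :: "'a set \<Rightarrow> 'a set set \<Rightarrow> bool" where
  "simple_graph V E \<longleftrightarrow> (\<forall>e\<in>E. e \<subseteq> V \<and> card e = 2)"

definition walk :: "'a set \<Rightarrow> 'a set set \<Rightarrow> 'a list \<Rightarrow> bool" where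
  "walk V E xs \<longleftrightarrow> xs \<noteq> [] \<and> set xs \<subseteq> V \<and> successively (\<lambda>x y. {x, y} \<in> E) xs"

definition connected_graph :: "'a set \<Rightarrow> 'a set set \<Rightarrow> bool" where
  "connected_graph V E \<longleftrightarrow>
     V \<noteq> {} \<and> (\<forall>x\<in>V. \<forall>y\<in>V. \<exists>xs. walk V E xs \<and> hd xs = x \<and> last xs = y)"

definition bipartite_graph :: "'a set \<Rightarrow> 'a set set \<Rightarrow> bool" where
  "bipartite_graph V E \<longleftrightarrow>
     (\<exists>A B. A \<union> B = V \<and> A \<inter> B = {} \<and> (\<forall>e\<in>E. \<exists>a\<in>A. \<exists>b\<in>B. e = {a, b}))"

definition vertex_degree :: "'a set set \<Rightarrow> 'a \<Rightarrow> nat" where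
  "vertex_degree E v = card {e \<in> E. v \<in> e}"

definition semiregular :: "nat \<Rightarrow> nat \<Rightarrow> 'a set \<Rightarrow> 'a set set \<Rightarrow> bool" where
  "semiregular p q V E \<longleftrightarrow>
     connected_graph V E \<and> bipartite_graph V E \<and>
     (\<forall>e\<in>E. \<exists>x y. e = {x, y} \<and> vertex_degree E x = p + 1 \<and> vertex_degree E y = q + 1)"

text \<open>Combinatorial distance; only meaningful for vertices joined by a path.\<close>

definition graph_dist :: "'a set \<Rightarrow> 'a set set \<Rightarrow> 'a \<Rightarrow> 'a \<Rightarrow> nat" where
  "graph_dist V E x y =
     (LEAST n. \<exists>xs. walk V E xs \<and> hd xs = x \<and> last xs = y \<and> length xs = n + 1)"

definition edge_sphere :: "'a set \<Rightarrow> 'a set set \<Rightarrow> 'a \<Rightarrow> nat \<Rightarrow> 'a set set" where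
  "edge_sphere V E v r =
     {e \<in> E. \<exists>x y. e = {x, y} \<and> min (graph_dist V E x v) (graph_dist V E y v) = r}"

text \<open>In a simple graph a path backtracks iff some vertex is revisited after exactly two steps.\<close>

definition nonbacktracking :: "'a list \<Rightarrow> bool" where
  "nonbacktracking xs \<longleftrightarrow> (\<forall>i. i + 2 < length xs \<longrightarrow> xs ! i \<noteq> xs ! (i + 2))"

definition cover_verts :: "'a set \<Rightarrow> 'a set set \<Rightarrow> 'a \<Rightarrow> 'a list set" where
  "cover_verts V E x0 = {xs. walk V E xs \<and> hd xs = x0 \<and> nonbacktracking xs}"

definition cover_edges :: "'a set \<Rightarrow> 'a set set \<Rightarrow> 'a \<Rightarrow> 'a list set set" where
  "cover_edges V E x0 =
     {{xs, xs @ [y]} | xs y. xs \<in> cover_verts V E x0 \<and> xs @ [y] \<in> cover_verts V E x0}"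

text \<open>
  The projection sends a path to its last vertex; on an edge \<open>{xs, xs @ [y]}\<close> of the cover its
  image is \<open>{last xs, y}\<close>, the edge by which the two paths differ.
\<close>

definition lift :: "('a set \<Rightarrow> real) \<Rightarrow> 'a list set \<Rightarrow> real" where
  "lift f e = f (last ` e)"

definition cover_sphere ::
    "'a set \<Rightarrow> 'a set set \<Rightarrow> 'a \<Rightarrow> 'a list \<Rightarrow> nat \<Rightarrow> 'a list set set" where
  "cover_sphere V E x0 v r = edge_sphere (cover_verts V E x0) (cover_edges V E x0) v r"

definition spherical_mean ::
    "'a set \<Rightarrow> 'a set set \<Rightarrow> 'a \<Rightarrow> ('a set \<Rightarrow> real) \<Rightarrow> 'a list \<Rightarrow> nat \<Rightarrow> real" where
  "spherical_mean V E x0 f v r =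
     (\<Sum>e\<in>cover_sphere V E x0 v r. lift f e) / real (card (cover_sphere V E x0 v r))"

end

theory Submission
  imports Defs "HOL-Library.Sublist"
begin

text \<open>
  Averaging over the edge sphere of radius \<open>r + 1\<close> amounts to averaging over the edge sphere of
  radius \<open>r\<close> the function \<open>P f\<close>, where \<open>(P f) e\<close> is the mean of \<open>f\<close> over the edges other than
  \<open>e\<close> at one endpoint of \<open>e\<close>; the side of the bipartition to which this endpoint belongs alternates
  with \<open>r\<close>. So the spherical means are computed by alternately applying the operators \<open>P\<^sub>A\<close> and
  \<open>P\<^sub>B\<close>, which act on each star as the self-adjoint matrix \<open>(J - I) / k\<close> with eigenvalues \<open>1\<close> (on
  constants) and \<open>-1 / k\<close>. The loss of squared norm under \<open>P\<^sub>A\<close> is therefore comparable to the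
  variation of \<open>f\<close> on the \<open>A\<close>-stars. By connectedness, the variation over all stars controls the norm
  of a function of mean zero, so \<open>P\<^sub>B P\<^sub>A\<close> and \<open>P\<^sub>A P\<^sub>B\<close> are strict contractions on such functions.
\<close>

section \<open>Averaging over stars\<close>

definition star :: "'a set set \<Rightarrow> 'a \<Rightarrow> 'a set set" where
  "star E v = {e \<in> E. v \<in> e}"

text \<open>For \<open>e\<close> in \<open>E\<close> the set \<open>e \<inter> S\<close> will be a
  singleton, so the sum over it selects the endpoint of \<open>e\<close> in \<open>S\<close> without
  a choice operator. Here \<open>k\<close> is one less than the degree of that endpoint.\<close>

definition edge_mean :: "'a set set \<Rightarrow> 'a set \<Rightarrow> nat \<Rightarrow> ('a set \<Rightarrow> real) \<Rightarrow> 'a set \<Rightarrow> real" where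
  "edge_mean E S k f e = ((\<Sum>v\<in>e \<inter> S. sum f (star E v)) - f e) / real k"

text \<open>A Dirichlet form on functions of edges, where edges count as adjacent when they share a
  vertex of \<open>S\<close>. It runs over ordered pairs, so each unordered pair at a vertex enters
  twice.\<close>

definition energy :: "'a set set \<Rightarrow> 'a set \<Rightarrow> ('a set \<Rightarrow> real) \<Rightarrow> real" where
  "energy E S f = (\<Sum>v\<in>S. \<Sum>e\<in>star E v. \<Sum>e'\<in>star E v. (f e - f e')\<^sup>2)"

text \<open>The variance identity. It evaluates the energy of one star, and nonnegativity of its
  left side is the Cauchy-Schwarz inequality against constants.\<close>

lemma sum_diff_squares:
  fixes f :: "'b \<Rightarrow> real"
  shows "(\<Sum>x\<in>T. \<Sum>y\<in>T. (f x - f y)\<^sup>2) = 2 * (card T * (\<Sum>x\<in>T. (f x)\<^sup>2) - (sum f T)\<^sup>2)"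
proof -
  have "(\<Sum>x\<in>T. \<Sum>y\<in>T. (f x - f y)\<^sup>2)
      = (\<Sum>x\<in>T. \<Sum>y\<in>T. (f x)\<^sup>2) + (\<Sum>x\<in>T. \<Sum>y\<in>T. (f y)\<^sup>2) - 2 * (\<Sum>x\<in>T. \<Sum>y\<in>T. f x * f y)"
    by (simp add: power2_diff sum.distrib sum_subtractf sum_distrib_left mult.assoc)
  also have "(\<Sum>x\<in>T. \<Sum>y\<in>T. f x * f y) = (sum f T)\<^sup>2"
    by (simp add: power2_eq_square sum_product)
  finally show ?thesis
    by (simp add: sum_distrib_left)
qed

section \<open>One side of the bipartition: the averaging operator and its loss of norm\<close>

locale edge_side =
  fixes E :: "'a set set" and S :: "'a set" and k :: nat
  assumes fin_E: "finite E" and fin_S: "finite S" and k2: "2 \<le> k"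
    and unique_end: "e \<in> E \<Longrightarrow> \<exists>v. e \<inter> S = {v}"
    and degree: "v \<in> S \<Longrightarrow> card (star E v) = k + 1"
begin

lemma fin_star [simp]: "finite (star E v)"
  using fin_E by (simp add: star_def)

lemma star_subset: "star E v \<subseteq> E"
  by (auto simp: star_def)

text \<open>Each edge has exactly one endpoint in \<open>S\<close>, so the stars centred in
  \<open>S\<close> partition \<open>E\<close>. All later estimates are thereby reduced to a single
  star.\<close>

lemma sum_stars: "sum g E = (\<Sum>v\<in>S. sum g (star E v))"
proof -
  have "E = (\<Union>v\<in>S. star E v)"
    using unique_end by (auto simp: star_def)
  moreover have "star E v \<inter> star E w = {}" if "v \<in> S" "w \<in> S" "v \<noteq> w" for v w
  proof -
    have "v = w" if "e \<in> E" "v \<in> e" "w \<in> e" for e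
      using unique_end[OF that(1)] that \<open>v \<in> S\<close> \<open>w \<in> S\<close> by (metis IntI singletonD)
    then show ?thesis
      using \<open>v \<noteq> w\<close> by (auto simp: star_def)
  qed
  ultimately show ?thesis
    using sum.UNION_disjoint[of S "star E" g] fin_S by simp
qed

lemma edge_mean_star:
  assumes "v \<in> S" "e \<in> star E v"
  shows "edge_mean E S k f e = (sum f (star E v) - f e) / k"
proof -
  have "e \<inter> S = {v}"
  proof -
    have "e \<in> E" "v \<in> e \<inter> S"
      using assms by (auto simp: star_def)
    then show ?thesis
      using unique_end[of e] by (metis singletonD)
  qed
  then show ?thesis
    by (simp add: edge_mean_def)
qed

text \<open>In a star of \<open>k + 1\<close> edges each value enters the averages at the
  \<open>k\<close> other edges with weight \<open>1 / k\<close>. Hence functions of mean zero stay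
  of mean zero under iteration.\<close>

lemma sum_edge_mean: "sum (edge_mean E S k f) E = sum f E"
proof -
  have "sum (edge_mean E S k f) (star E v) = sum f (star E v)" if "v \<in> S" for v
  proof -
    have "sum (edge_mean E S k f) (star E v) = (\<Sum>e\<in>star E v. (sum f (star E v) - f e) / k)"
      using that by (intro sum.cong) (auto simp: edge_mean_star)
    also have "\<dots> = sum f (star E v)"
      using k2 degree[OF that]
      by (simp add: sum_divide_distrib[symmetric] sum_subtractf field_simps)
    finally show ?thesis .
  qed
  then show ?thesis
    by (simp add: sum_stars)
qed

lemma edge_mean_one: "e \<in> E \<Longrightarrow> edge_mean E S k (\<lambda>_. 1) e = 1"
  using unique_end[of e] edge_mean_star[of _ e] degree k2 by (fastforce simp: star_def)

lemma energy_nonneg: "0 \<le> energy E S f"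
  unfolding energy_def by (intro sum_nonneg) auto

text \<open>On a star the operator is the identity on constants and \<open>-1 / k\<close> on their
  orthogonal complement, so the loss is \<open>1 - 1 / k^2\<close> times the squared deviation from
  the star mean. The energy of the star is \<open>2 * (k + 1)\<close> times that squared deviation,
  and the quotient of the two factors is the constant here. It is positive because
  \<open>k \<ge> 2\<close>.\<close>

lemma energy_drop:
  "(\<Sum>e\<in>E. (f e)\<^sup>2) - (\<Sum>e\<in>E. (edge_mean E S k f e)\<^sup>2)
     = (real k - 1) / (2 * (real k)\<^sup>2) * energy E S f"
proof -
  have "(\<Sum>e\<in>star E v. (f e)\<^sup>2) - (\<Sum>e\<in>star E v. (edge_mean E S k f e)\<^sup>2)
      = (real k - 1) / (2 * (real k)\<^sup>2) * (\<Sum>e\<in>star E v. \<Sum>e'\<in>star E v. (f e - f e')\<^sup>2)"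
    if "v \<in> S" for v
  proof -
    define s where "s = sum f (star E v)"
    define Q where "Q = (\<Sum>e\<in>star E v. (f e)\<^sup>2)"
    have "(\<Sum>e\<in>star E v. (edge_mean E S k f e)\<^sup>2) = (\<Sum>e\<in>star E v. ((s - f e) / k)\<^sup>2)"
      using that by (intro sum.cong) (auto simp: edge_mean_star s_def)
    also have "\<dots> = (\<Sum>e\<in>star E v. s\<^sup>2 - 2 * s * f e + (f e)\<^sup>2) / (real k)\<^sup>2"
      by (simp add: power_divide sum_divide_distrib[symmetric] power2_diff add_diff_eq diff_add_eq
        mult.assoc)
    \<comment> \<open>The \<open>k + 1\<close> edges contribute \<open>(k + 1) * s^2\<close>, and
      the cross term removes \<open>2 * s^2\<close>.\<close>
    also have "(\<Sum>e\<in>star E v. s\<^sup>2 - 2 * s * f e + (f e)\<^sup>2) = (k - 1) * s\<^sup>2 + Q"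
      using degree[OF that] k2
      by (simp add: sum.distrib sum_subtractf sum_distrib_left[symmetric] s_def[symmetric]
          Q_def[symmetric])
        (simp add: power2_eq_square algebra_simps of_nat_diff)
    finally show ?thesis
      unfolding sum_diff_squares s_def[symmetric] Q_def[symmetric] degree[OF that]
      using k2 by (simp add: field_simps power2_eq_square of_nat_diff)
  qed
  then show ?thesis
    unfolding energy_def sum_stars sum_subtractf[symmetric] sum_distrib_left[of _ _ S]
    by (intro sum.cong) (auto simp: sum_subtractf)
qed

lemma edge_mean_norm_le: "(\<Sum>e\<in>E. (edge_mean E S k f e)\<^sup>2) \<le> (\<Sum>e\<in>E. (f e)\<^sup>2)"
proof -
  have "0 \<le> (real k - 1) / (2 * (real k)\<^sup>2) * energy E S f"
    using k2 energy_nonneg by (intro mult_nonneg_nonneg divide_nonneg_nonneg) auto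
  then show ?thesis
    using energy_drop[of f] by linarith
qed

text \<open>\<open>f e\<close> minus its average is \<open>1 / k\<close> times the sum of
  \<open>f e - f e'\<close> over the star, and Cauchy-Schwarz over the \<open>k + 1\<close> terms
  gives the constant. This controls how far one averaging step moves \<open>f\<close> when its
  energy is small.\<close>

lemma displacement_le:
  "(\<Sum>e\<in>E. (f e - edge_mean E S k f e)\<^sup>2) \<le> (real k + 1) / (real k)\<^sup>2 * energy E S f"
proof -
  have "(\<Sum>e\<in>star E v. (f e - edge_mean E S k f e)\<^sup>2)
      \<le> (real k + 1) / (real k)\<^sup>2 * (\<Sum>e\<in>star E v. \<Sum>e'\<in>star E v. (f e - f e')\<^sup>2)"
    if "v \<in> S" for v
    unfolding sum_distrib_left[of _ _ "star E v"]
  proof (rule sum_mono)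
    fix e assume e: "e \<in> star E v"
    have "f e - edge_mean E S k f e = (\<Sum>e'\<in>star E v. f e - f e') / k"
      using e that k2 degree[OF that] by (simp add: edge_mean_star sum_subtractf field_simps)
    then have "(f e - edge_mean E S k f e)\<^sup>2 = (\<Sum>e'\<in>star E v. f e - f e')\<^sup>2 / (real k)\<^sup>2"
      by (simp add: power_divide)
    also have "\<dots> \<le> ((real k + 1) * (\<Sum>e'\<in>star E v. (f e - f e')\<^sup>2)) / (real k)\<^sup>2"
    proof (rule divide_right_mono)
      \<comment> \<open>Cauchy-Schwarz, read off from the variance identity for the function sending
        \<open>e'\<close> to \<open>f e - f e'\<close>.\<close>
      have "0 \<le> (\<Sum>x\<in>star E v. \<Sum>y\<in>star E v. ((f e - f x) - (f e - f y))\<^sup>2)"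
        by (intro sum_nonneg) auto
      then show "(\<Sum>e'\<in>star E v. f e - f e')\<^sup>2
          \<le> (real k + 1) * (\<Sum>e'\<in>star E v. (f e - f e')\<^sup>2)"
        unfolding sum_diff_squares degree[OF that] by (simp add: add.commute)
    qed simp
    finally show "(f e - edge_mean E S k f e)\<^sup>2
        \<le> (\<Sum>e'\<in>star E v. (real k + 1) / (real k)\<^sup>2 * (f e - f e')\<^sup>2)"
      by (simp add: sum_distrib_left sum_divide_distrib)
  qed
  then show ?thesis
    unfolding energy_def sum_stars sum_distrib_left[of _ _ S] by (intro sum_mono) auto
qed

lemma energy_le_norm: "energy E S f \<le> 2 * (real k + 1) * (\<Sum>e\<in>E. (f e)\<^sup>2)"
  unfolding energy_def sum_stars sum_distrib_left[of _ _ S] sum_diff_squares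
  by (intro sum_mono) (auto simp: degree algebra_simps)

lemma energy_add_le: "energy E S (\<lambda>e. f e + g e) \<le> 2 * energy E S f + 2 * energy E S g"
proof -
  have "(a + b)\<^sup>2 \<le> 2 * a\<^sup>2 + 2 * b\<^sup>2" for a b :: real
    using sum_squares_bound[of a b] by (simp add: power2_sum)
  from this[of "f e - f e'" "g e - g e'" for e e']
  have "(f e + g e - (f e' + g e'))\<^sup>2 \<le> 2 * (f e - f e')\<^sup>2 + 2 * (g e - g e')\<^sup>2" for e e'
    by (simp add: algebra_simps)
  then show ?thesis
    unfolding energy_def sum_distrib_left sum.distrib[symmetric] by (intro sum_mono)
qed

lemma diff_le_energy:
  assumes "v \<in> S" "e \<in> star E v" "e' \<in> star E v"
  shows "(f e - f e')\<^sup>2 \<le> energy E S f"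
proof -
  have "(f e - f e')\<^sup>2 \<le> (\<Sum>y\<in>star E v. (f e - f y)\<^sup>2)"
    using assms by (intro member_le_sum[of e' _ "\<lambda>y. (f e - f y)\<^sup>2"]) auto
  also have "\<dots> \<le> (\<Sum>x\<in>star E v. \<Sum>y\<in>star E v. (f x - f y)\<^sup>2)"
    using assms by (intro member_le_sum[of e _ "\<lambda>x. \<Sum>y\<in>star E v. (f x - f y)\<^sup>2"]) (auto intro: sum_nonneg)
  also have "\<dots> \<le> energy E S f"
    unfolding energy_def using assms fin_S
    by (intro member_le_sum[of v _ "\<lambda>v. \<Sum>x\<in>star E v. \<Sum>y\<in>star E v. (f x - f y)\<^sup>2"])
      (auto intro!: sum_nonneg)
  finally show ?thesis .
qed

end

section \<open>Poincare inequality and contraction over two averaging steps\<close>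

locale semiregular_graph =
  fixes V :: "'a set" and E :: "'a set set" and A B :: "'a set" and p q :: nat
  assumes fin_V: "finite V" and conn: "connected_graph V E" and E_ne: "E \<noteq> {}"
    and V_eq: "V = A \<union> B" and disj: "A \<inter> B = {}"
    and p2: "2 \<le> p" and q2: "2 \<le> q"
    and bip: "e \<in> E \<Longrightarrow> \<exists>a\<in>A. \<exists>b\<in>B. e = {a, b}"
    and degA: "v \<in> A \<Longrightarrow> card (star E v) = p + 1"
    and degB: "v \<in> B \<Longrightarrow> card (star E v) = q + 1"
begin

text \<open>Everything is proved for one order of the sides; this symmetry supplies the other order
  of the operators and basepoints over the other side.\<close>

lemma swap: "semiregular_graph V E B A q p"
proof
  show "\<exists>a\<in>B. \<exists>b\<in>A. e = {a, b}" if "e \<in> E" for e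
  proof -
    obtain a b where "a \<in> A" "b \<in> B" "e = {b, a}"
      using bip[OF \<open>e \<in> E\<close>] by (auto simp: insert_commute)
    then show ?thesis
      by blast
  qed
qed (use fin_V conn E_ne V_eq disj p2 q2 degA degB in auto)

lemma edge_sub: "e \<in> E \<Longrightarrow> e \<subseteq> V"
  using bip V_eq by blast

lemma fin_E: "finite E"
  by (rule finite_subset[of E "Pow V"]) (use edge_sub fin_V in auto)

lemma side_A: "edge_side E A p"
proof
  show "\<exists>v. e \<inter> A = {v}" if "e \<in> E" for e
    using bip[OF that] disj by blast
qed (use fin_E fin_V V_eq p2 degA in auto)

lemma side_B: "edge_side E B q"
  using semiregular_graph.side_A[OF swap] .

lemma energy_V: "energy E V f = energy E A f + energy E B f"
  unfolding energy_def V_eq using fin_V V_eq disj by (intro sum.union_disjoint) auto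

text \<open>Along a walk from \<open>e\<close> to \<open>e'\<close> consecutive edges share a
  vertex, and \<open>f\<close> changes by at most the square root of the energy from one to the
  next. The number \<open>n\<close> depends on the walk only; its choice before \<open>f\<close> is
  what makes the Poincare constant uniform.\<close>

lemma edges_linked:
  assumes "e \<in> E" "e' \<in> E"
  shows "\<exists>n. \<forall>f. \<bar>f e - f e'\<bar> \<le> real n * sqrt (energy E V f)"
proof -
  have adj: "\<bar>f e - f e'\<bar> \<le> sqrt (energy E V f)"
    if "e \<in> E" "e' \<in> E" "v \<in> e" "v \<in> e'" for e e' v and f :: "'a set \<Rightarrow> real"
  proof -
    have nonneg: "0 \<le> energy E A f" "0 \<le> energy E B f"
      by (rule edge_side.energy_nonneg[OF side_A] edge_side.energy_nonneg[OF side_B])+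
    have stars: "e \<in> star E v" "e' \<in> star E v"
      using that by (auto simp: star_def)
    have "v \<in> A \<or> v \<in> B"
      using that edge_sub[of e] V_eq by auto
    then have "(f e - f e')\<^sup>2 \<le> energy E A f \<or> (f e - f e')\<^sup>2 \<le> energy E B f"
      using edge_side.diff_le_energy[OF side_A _ stars] edge_side.diff_le_energy[OF side_B _ stars]
      by blast
    then have "(f e - f e')\<^sup>2 \<le> energy E V f"
      using nonneg unfolding energy_V by linarith
    then show ?thesis
      using real_le_rsqrt[of "\<bar>f e - f e'\<bar>"] by simp
  qed
  \<comment> \<open>The walk is only required to start at some vertex of \<open>e\<close>, so the
    induction can replace \<open>e\<close> by the first edge of the walk.\<close>
  have "\<exists>n. \<forall>f. \<bar>f e - f e'\<bar> \<le> real n * sqrt (energy E V f)"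
    if "successively (\<lambda>x y. {x, y} \<in> E) xs" "xs \<noteq> []" "hd xs \<in> e" "e \<in> E" "last xs \<in> e'" for xs e
    using that
  proof (induction xs arbitrary: e rule: induct_list012)
    case (2 x)
    then show ?case
      using adj[of e e' x] assms by (auto intro!: exI[of _ 1])
  next
    case (3 x y zs)
    then obtain n where n: "\<And>f. \<bar>f {x, y} - f e'\<bar> \<le> real n * sqrt (energy E V f)"
      using "3.IH"(2)[of "{x, y}"] "3.prems"
      by (metis (lifting) insert_iff last.simps list.distinct(1) list.sel(1) successively.simps(3))
    have "\<bar>f e - f e'\<bar> \<le> real (Suc n) * sqrt (energy E V f)" for f
      using n[of f] adj[of e "{x, y}" x f] 3 by (auto simp: algebra_simps)
    then show ?case
      by blast
  qed simp
  moreover obtain x y where "x \<in> e" "y \<in> e'"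
    using bip[OF assms(1)] bip[OF assms(2)] by auto
  moreover from this have "x \<in> V" "y \<in> V"
    using edge_sub assms by auto
  moreover from this obtain xs where "walk V E xs" "hd xs = x" "last xs = y"
    using conn unfolding connected_graph_def by blast
  ultimately show ?thesis
    using assms by (auto simp: walk_def)
qed

text \<open>For mean zero, \<open>f e\<close> is the average over \<open>e'\<close> of
  \<open>f e - f e'\<close>, and each difference is controlled by the energy. Since there are
  finitely many pairs of edges, the largest link length \<open>L\<close> serves for all of
  them.\<close>

lemma poincare:
  obtains M :: real where "0 \<le> M"
    "\<And>f. sum f E = 0 \<Longrightarrow> (\<Sum>e\<in>E. (f e)\<^sup>2) \<le> M * energy E V f"
proof -
  obtain n where n: "\<And>e e' f. e \<in> E \<Longrightarrow> e' \<in> E \<Longrightarrow>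
      \<bar>f e - f e'\<bar> \<le> real (n e e') * sqrt (energy E V f)"
    using edges_linked by metis
  define L where "L = Max ((\<lambda>(e, e'). n e e') ` (E \<times> E))"
  have energy0: "0 \<le> energy E V f" for f
    using edge_side.energy_nonneg[OF side_A, of f] edge_side.energy_nonneg[OF side_B, of f]
    by (simp add: energy_V)
  have L: "\<bar>f e - f e'\<bar> \<le> real L * sqrt (energy E V f)" if "e \<in> E" "e' \<in> E" for e e' f
  proof -
    have "n e e' \<le> L"
      unfolding L_def using that fin_E by (intro Max_ge) auto
    then have "real (n e e') * sqrt (energy E V f) \<le> real L * sqrt (energy E V f)"
      using energy0 by (intro mult_right_mono) auto
    then show ?thesis
      using n[OF that, of f] by linarith
  qed
  have "(\<Sum>e\<in>E. (f e)\<^sup>2) \<le> (card E * (real L)\<^sup>2) * energy E V f" if f0: "sum f E = 0" for f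
  proof -
    have "(f e)\<^sup>2 \<le> (real L)\<^sup>2 * energy E V f" if "e \<in> E" for e
    proof -
      have "card E * f e = (\<Sum>e'\<in>E. f e - f e')"
        using f0 by (simp add: sum_subtractf)
      then have "card E * \<bar>f e\<bar> = \<bar>\<Sum>e'\<in>E. f e - f e'\<bar>"
        by (metis abs_mult abs_of_nat)
      also have "\<dots> \<le> (\<Sum>e'\<in>E. real L * sqrt (energy E V f))"
        using L that by (intro order_trans[OF sum_abs] sum_mono) auto
      also have "\<dots> = card E * (real L * sqrt (energy E V f))"
        by simp
      finally have "\<bar>f e\<bar> \<le> real L * sqrt (energy E V f)"
        using fin_E E_ne by (simp add: card_gt_0_iff)
      then have "\<bar>f e\<bar>\<^sup>2 \<le> (real L * sqrt (energy E V f))\<^sup>2"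
        by (intro power_mono) auto
      then show ?thesis
        using energy0 by (simp add: power_mult_distrib)
    qed
    from sum_mono[OF this] show ?thesis
      by (simp add: mult.assoc)
  qed
  then show ?thesis
    by (intro that[of "card E * (real L)\<^sup>2"]) auto
qed

text \<open>One step may lose nothing, for instance on functions constant on the
  \<open>A\<close>-stars. The two losses together dominate the energy over both sides, hence by the
  Poincare inequality the whole squared norm.\<close>

lemma two_step_contraction:
  obtains \<gamma> :: real where "0 \<le> \<gamma>" "\<gamma> < 1"
    "\<And>f. sum f E = 0 \<Longrightarrow>
       (\<Sum>e\<in>E. (edge_mean E B q (edge_mean E A p f) e)\<^sup>2) \<le> \<gamma> * (\<Sum>e\<in>E. (f e)\<^sup>2)"
proof -
  interpret A: edge_side E A p by (rule side_A)
  interpret B: edge_side E B q by (rule side_B)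
  obtain M where M: "0 \<le> M" "\<And>f. sum f E = 0 \<Longrightarrow> (\<Sum>e\<in>E. (f e)\<^sup>2) \<le> M * energy E V f"
    using poincare by blast
  define N where "N = (\<lambda>f::'a set \<Rightarrow> real. \<Sum>e\<in>E. (f e)\<^sup>2)"
  define a where "a = (real p - 1) / (2 * (real p)\<^sup>2)"
  define b where "b = (real q - 1) / (2 * (real q)\<^sup>2)"
  \<comment> \<open>A factor \<open>2\<close> from \<open>energy_add_le\<close>,
    \<open>2 * (q + 1)\<close> from \<open>energy_le_norm\<close>, and the constant of
    \<open>displacement_le\<close> on the \<open>A\<close> side.\<close>
  define c where "c = 4 * (real q + 1) * ((real p + 1) / (real p)\<^sup>2)"
  have pos: "0 < a" "0 < b" "0 \<le> c"
    using p2 q2 by (auto simp: a_def b_def c_def)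
  \<comment> \<open>Chosen so that \<open>N f \<le> X * (N f - N g)\<close> holds for the two-step
    image \<open>g\<close> of a mean-zero \<open>f\<close>.\<close>
  define X where "X = M * ((1 + c) / a + 2 / b)"
  have X0: "0 \<le> X"
    using pos M by (auto simp: X_def)
  have "N (edge_mean E B q (edge_mean E A p f)) \<le> X / (X + 1) * N f" if f0: "sum f E = 0" for f
  proof -
    define h where "h = edge_mean E A p f"
    define g where "g = edge_mean E B q h"
    have dA: "N f - N h = a * energy E A f" and dB: "N h - N g = b * energy E B h"
      unfolding N_def h_def g_def a_def b_def by (fact A.energy_drop B.energy_drop)+
    \<comment> \<open>The second loss measures the \<open>B\<close>-energy of \<open>h\<close>, not
      of \<open>f\<close>. The discrepancy \<open>f - h\<close> is paid for by the
      \<open>A\<close>-energy of \<open>f\<close>, that is, by the first loss.\<close>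
    have "energy E B f \<le> 2 * energy E B h + 2 * energy E B (\<lambda>e. f e - h e)"
      using B.energy_add_le[of h "\<lambda>e. f e - h e"] by simp
    moreover have "energy E B (\<lambda>e. f e - h e) \<le> 2 * (real q + 1) * N (\<lambda>e. f e - h e)"
      unfolding N_def by (rule B.energy_le_norm)
    moreover have "2 * (real q + 1) * N (\<lambda>e. f e - h e)
        \<le> 2 * (real q + 1) * ((real p + 1) / (real p)\<^sup>2 * energy E A f)"
      unfolding N_def h_def by (rule mult_left_mono[OF A.displacement_le]) auto
    moreover have "c * energy E A f
        = 2 * (2 * (real q + 1) * ((real p + 1) / (real p)\<^sup>2 * energy E A f))"
      by (simp add: c_def)
    ultimately have "energy E B f \<le> 2 * energy E B h + c * energy E A f"
      by linarith
    then have "energy E V f \<le> (1 + c) * energy E A f + 2 * energy E B h"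
      by (simp add: energy_V algebra_simps)
    moreover have "energy E A f = (N f - N h) / a" "energy E B h = (N h - N g) / b"
      using dA dB pos by auto
    ultimately have V: "energy E V f \<le> (1 + c) / a * (N f - N h) + 2 / b * (N h - N g)"
      by simp
    have le: "N h \<le> N f" "N g \<le> N h"
      unfolding N_def h_def g_def by (fact A.edge_mean_norm_le B.edge_mean_norm_le)+
    have "(1 + c) / a * (N f - N h) \<le> (1 + c) / a * (N f - N g)"
      using le pos by (intro mult_left_mono) auto
    moreover have "2 / b * (N h - N g) \<le> 2 / b * (N f - N g)"
      using le pos by (intro mult_left_mono) auto
    ultimately have "energy E V f \<le> ((1 + c) / a + 2 / b) * (N f - N g)"
      using V unfolding distrib_right by linarith
    then have "M * energy E V f \<le> X * (N f - N g)"
      unfolding X_def using mult_left_mono[OF _ M(1)] by (simp add: mult.assoc)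
    then have "N f \<le> X * (N f - N g)"
      using M(2)[OF f0] by (simp add: N_def)
    \<comment> \<open>Adding \<open>N g \<le> N f\<close> produces the factor
      \<open>X / (X + 1)\<close>, which lies in \<open>[0, 1)\<close> for every
      \<open>X \<ge> 0\<close>.\<close>
    then have "(X + 1) * N g \<le> X * N f"
      using le by (simp add: algebra_simps)
    then show ?thesis
      using X0 by (simp add: g_def h_def field_simps)
  qed
  then show ?thesis
    using X0 by (intro that[of "X / (X + 1)"]) (auto simp: N_def)
qed

end

section \<open>Spheres in the universal cover\<close>

text \<open>A candidate \<open>d\<close> is the distance to \<open>w\<close> if it changes by at
  most one along edges and can always be decreased by one away from \<open>w\<close>: descending
  yields a walk of length \<open>d x\<close>, and no walk is shorter.\<close>

lemma graph_dist_eqI: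
  assumes d0: "\<And>x. x \<in> V \<Longrightarrow> d x = 0 \<longleftrightarrow> x = w"
    and step: "\<And>x y. {x, y} \<in> E \<Longrightarrow> x \<in> V \<Longrightarrow> y \<in> V \<Longrightarrow> d x \<le> d y + 1"
    and parent: "\<And>x. x \<in> V \<Longrightarrow> 0 < d x \<Longrightarrow> \<exists>y\<in>V. {x, y} \<in> E \<and> d x = d y + 1"
    and x: "x \<in> V" and w: "w \<in> V"
  shows "graph_dist V E x w = d x"
  unfolding graph_dist_def
proof (rule Least_equality)
  show "\<exists>xs. walk V E xs \<and> hd xs = x \<and> last xs = w \<and> length xs = d x + 1"
    using x
  proof (induction "d x" arbitrary: x)
    case 0
    then show ?case
      using d0 by (auto simp: walk_def intro!: exI[of _ "[w]"])
  next
    case (Suc n)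
    then obtain y where y: "y \<in> V" "{x, y} \<in> E" "d x = d y + 1"
      using parent by fastforce
    with Suc obtain ys where "walk V E ys" "hd ys = y" "last ys = w" "length ys = d y + 1"
      by fastforce
    with y Suc show ?case
      by (auto simp: walk_def successively_Cons intro!: exI[of _ "x # ys"])
  qed
  fix n
  assume "\<exists>xs. walk V E xs \<and> hd xs = x \<and> last xs = w \<and> length xs = n + 1"
  then obtain xs where xs: "walk V E xs" "hd xs = x" "last xs = w" "length xs = n + 1"
    by blast
  \<comment> \<open>Lower bound: each edge of a walk lowers \<open>d\<close> by at most one.\<close>
  have "d (hd xs) \<le> d (last xs) + (length xs - 1)" if "walk V E xs" for xs
    using that
  proof (induction xs rule: induct_list012)
    case (3 a b xs)
    then have "d b \<le> d (last (b # xs)) + length xs" "d a \<le> d b + 1"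
      using step by (auto simp: walk_def)
    then show ?case
      by auto
  qed (auto simp: walk_def)
  from this[OF xs(1)] show "d x \<le> n"
    using xs d0[OF w] by simp
qed

lemma longest_common_prefix_snoc:
  "longest_common_prefix (xs @ [y]) w =
     (if prefix (xs @ [y]) w then xs @ [y] else longest_common_prefix xs w)"
proof (rule prefix_order.antisym)
  let ?l = "longest_common_prefix (xs @ [y]) w"
  have l: "prefix ?l (xs @ [y])" "prefix ?l w"
    by (rule longest_common_prefix_prefix1 longest_common_prefix_prefix2)+
  then show "prefix ?l (if prefix (xs @ [y]) w then xs @ [y] else longest_common_prefix xs w)"
    by (auto intro: longest_common_prefix_max_prefix)
  have "prefix (longest_common_prefix xs w) (xs @ [y])" "prefix (longest_common_prefix xs w) w"
    using longest_common_prefix_prefix1[of xs w] longest_common_prefix_prefix2 by auto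
  then show "prefix (if prefix (xs @ [y]) w then xs @ [y] else longest_common_prefix xs w) ?l"
    by (auto intro: longest_common_prefix_max_prefix)
qed

lemma longest_common_prefix_id: "prefix xs w \<Longrightarrow> longest_common_prefix xs w = xs"
  by (intro prefix_order.antisym longest_common_prefix_prefix1 longest_common_prefix_max_prefix)
    auto

text \<open>The distance in the tree of words: cut \<open>x\<close> back to the common prefix and extend it to \<open>w\<close>.\<close>

definition tree_dist :: "'b list \<Rightarrow> 'b list \<Rightarrow> nat" where
  "tree_dist w x = (length x - length (longest_common_prefix x w))
     + (length w - length (longest_common_prefix x w))"

text \<open>If the appended letter still follows \<open>w\<close>, the word gets closer to
  \<open>w\<close>; otherwise the common prefix is unchanged and the word gets farther away. No edge
  of the tree stays at equal distance.\<close>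

lemma tree_dist_snoc:
  shows "prefix (x @ [a]) w \<Longrightarrow> tree_dist w x = tree_dist w (x @ [a]) + 1"
    and "\<not> prefix (x @ [a]) w \<Longrightarrow> tree_dist w (x @ [a]) = tree_dist w x + 1"
proof -
  assume p: "prefix (x @ [a]) w"
  then have "prefix x w" "length (x @ [a]) \<le> length w"
    by (auto dest: append_prefixD prefix_length_le)
  with p show "tree_dist w x = tree_dist w (x @ [a]) + 1"
    by (simp add: tree_dist_def longest_common_prefix_id)
next
  assume "\<not> prefix (x @ [a]) w"
  then show "tree_dist w (x @ [a]) = tree_dist w x + 1"
    using longest_common_prefix_prefix1[of x w, THEN prefix_length_le]
    by (simp add: tree_dist_def longest_common_prefix_snoc)
qed

lemma tree_dist_eq_0_iff: "tree_dist w x = 0 \<longleftrightarrow> x = w"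
proof
  assume "tree_dist w x = 0"
  then have len: "length x \<le> length (longest_common_prefix x w)"
      "length w \<le> length (longest_common_prefix x w)"
    by (auto simp: tree_dist_def)
  have "x = longest_common_prefix x w"
    using longest_common_prefix_prefix1[of x w] len(1) by (metis prefixE append_eq_conv_conj take_all)
  also have "\<dots> = w"
    using longest_common_prefix_prefix2[of x w] len(2) by (metis prefixE append_eq_conv_conj take_all)
  finally show "x = w" .
qed (simp add: tree_dist_def longest_common_prefix_id)

section \<open>Non-backtracking paths and their one-letter extensions\<close>

lemma nonbacktracking_append: "nonbacktracking (xs @ ys) \<Longrightarrow> nonbacktracking xs"
proof -
  assume *: "nonbacktracking (xs @ ys)"
  show ?thesis
    unfolding nonbacktracking_def
  proof (intro allI impI)
    fix i assume "i + 2 < length xs"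
    then show "xs ! i \<noteq> xs ! (i + 2)"
      using *[unfolded nonbacktracking_def, rule_format, of i] by (simp add: nth_append)
  qed
qed

text \<open>Only the last triple is new, so the admissible extensions of a path depend on its last
  two vertices alone.\<close>

lemma nonbacktracking_snoc:
  "nonbacktracking (xs @ [a, b, c]) \<longleftrightarrow> nonbacktracking (xs @ [a, b]) \<and> a \<noteq> c"
proof
  assume *: "nonbacktracking (xs @ [a, b, c])"
  then have "a \<noteq> c"
    unfolding nonbacktracking_def by (auto simp: nth_append dest: spec[of _ "length xs"])
  moreover have "nonbacktracking (xs @ [a, b])"
    using nonbacktracking_append[of "xs @ [a, b]" "[c]"] * by simp
  ultimately show "nonbacktracking (xs @ [a, b]) \<and> a \<noteq> c"
    by simp
next
  assume *: "nonbacktracking (xs @ [a, b]) \<and> a \<noteq> c"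
  show "nonbacktracking (xs @ [a, b, c])"
    unfolding nonbacktracking_def
  proof (intro allI impI)
    fix i assume i: "i + 2 < length (xs @ [a, b, c])"
    show "(xs @ [a, b, c]) ! i \<noteq> (xs @ [a, b, c]) ! (i + 2)"
    proof (cases "i = length xs")
      case False
      then have "i + 2 < length (xs @ [a, b])"
        using i by simp
      moreover from this have "(xs @ [a, b]) ! i \<noteq> (xs @ [a, b]) ! (i + 2)"
        using * unfolding nonbacktracking_def by blast
      ultimately show ?thesis
        using nth_append[of "xs @ [a, b]" "[c]"] by simp
    qed (use * in \<open>auto simp: nth_append\<close>)
  qed
qed

lemma nonbacktracking_short: "length xs \<le> 2 \<Longrightarrow> nonbacktracking xs"
  by (auto simp: nonbacktracking_def)

section \<open>The universal cover as a tree seen from the basepoint \<open>w\<close>\<close>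

locale cover =
  fixes V :: "'a set" and E :: "'a set set" and x0 :: 'a and w :: "'a list"
  assumes simple: "simple_graph V E" and fin_E: "finite E"
    and x0: "x0 \<in> V" and w: "w \<in> cover_verts V E x0"
begin

abbreviation "CV \<equiv> cover_verts V E x0"
abbreviation "CE \<equiv> cover_edges V E x0"

definition nbrs :: "'a list \<Rightarrow> 'a list set" where
  "nbrs x = {y. {x, y} \<in> CE}"

lemma edgeD: "{a, b} \<in> E \<Longrightarrow> a \<in> V \<and> b \<in> V \<and> a \<noteq> b"
  using simple unfolding simple_graph_def by (metis card_2_iff doubleton_eq_iff insert_subset)

lemma CV_nonempty: "x \<in> CV \<Longrightarrow> x \<noteq> []"
  by (auto simp: cover_verts_def walk_def)

lemma singleton_CV: "[a] \<in> CV \<longleftrightarrow> a = x0"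
  using x0 by (auto simp: cover_verts_def walk_def nonbacktracking_short)

lemma snoc_CV_D: "x @ [a] \<in> CV \<Longrightarrow> x \<noteq> [] \<Longrightarrow> x \<in> CV \<and> {last x, a} \<in> E"
  by (auto simp: cover_verts_def walk_def successively_append_iff dest: nonbacktracking_append)

lemma snoc_CV_iff:
  assumes "y @ [b] \<in> CV" "y \<noteq> []"
  shows "y @ [b, a] \<in> CV \<longleftrightarrow> {b, a} \<in> E \<and> a \<noteq> last y"
proof -
  obtain ys c where y: "y = ys @ [c]"
    using assms by (metis append_butlast_last_id)
  show ?thesis
    using assms edgeD[of b a] nonbacktracking_snoc[of ys c b a] unfolding y
    by (auto simp: cover_verts_def walk_def successively_append_iff successively_Cons hd_append)
qed

lemma snoc_root_CV_iff: "[x0, a] \<in> CV \<longleftrightarrow> {x0, a} \<in> E"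
  using edgeD[of x0 a] by (auto simp: cover_verts_def walk_def nonbacktracking_short)

lemma nbrs_iff:
  "y \<in> nbrs x \<longleftrightarrow> x \<in> CV \<and> y \<in> CV \<and> (\<exists>a. y = x @ [a] \<or> x = y @ [a])"
  unfolding nbrs_def cover_edges_def by (auto simp: doubleton_eq_iff)

lemma nbrs_sym: "y \<in> nbrs x \<longleftrightarrow> x \<in> nbrs y"
  by (auto simp: nbrs_iff)

lemma nbrs_edge: "y \<in> nbrs x \<Longrightarrow> {last x, last y} \<in> E"
  using snoc_CV_D CV_nonempty by (auto simp: nbrs_iff insert_commute)

text \<open>The covering property: the projection is a bijection on the neighbours of each vertex.
  Deleting the last letter covers the previous vertex, and the extensions cover exactly the
  remaining neighbours; at the root there are only extensions.\<close>

lemma last_nbrs: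
  assumes x: "x \<in> CV"
  shows "bij_betw last (nbrs x) {u. {last x, u} \<in> E}"
proof (cases x rule: rev_cases)
  case Nil
  then show ?thesis
    using CV_nonempty x by auto
next
  case (snoc y b)
  show ?thesis
  proof (cases "y = []")
    case True
    then have "x = [x0]"
      using snoc x singleton_CV by auto
    then have "nbrs x = (\<lambda>a. [x0, a]) ` {u. {last x, u} \<in> E}"
      using x snoc_root_CV_iff CV_nonempty[of "[]"] by (auto simp: nbrs_iff)
    then show ?thesis
      by (auto simp: bij_betw_def inj_on_def image_image)
  next
    case False
    have y: "y \<in> CV" "{last y, b} \<in> E"
      using snoc_CV_D x snoc False by auto
    have n: "nbrs x = insert y ((\<lambda>a. y @ [b, a]) ` {u. {b, u} \<in> E \<and> u \<noteq> last y})"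
    proof (intro set_eqI iffI)
      fix z assume "z \<in> nbrs x"
      then have z: "z \<in> CV" "z = y \<or> (\<exists>a. z = y @ [b, a])"
        by (auto simp: nbrs_iff snoc)
      then show "z \<in> insert y ((\<lambda>a. y @ [b, a]) ` {u. {b, u} \<in> E \<and> u \<noteq> last y})"
        using snoc_CV_iff[of y b] x snoc False by blast
    next
      fix z assume "z \<in> insert y ((\<lambda>a. y @ [b, a]) ` {u. {b, u} \<in> E \<and> u \<noteq> last y})"
      then show "z \<in> nbrs x"
        using snoc_CV_iff[of y b] x y False unfolding nbrs_iff snoc by force
    qed
    have "{b, last y} \<in> E"
      using y by (simp add: insert_commute)
    then have "last ` nbrs x = {u. {last x, u} \<in> E}"
      unfolding n by (auto simp: image_image snoc)
    moreover have "inj_on last (nbrs x)"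
      unfolding n by (auto simp: inj_on_def)
    ultimately show ?thesis
      by (simp add: bij_betw_def)
  qed
qed

lemma finite_nbrs: "finite (nbrs x)"
proof (cases "x \<in> CV")
  case True
  have "inj_on (\<lambda>u. {last x, u}) {u. {last x, u} \<in> E}"
    by (auto simp: inj_on_def doubleton_eq_iff)
  then have "finite {u. {last x, u} \<in> E}"
    by (rule inj_on_finite) (use fin_E in auto)
  then show ?thesis
    using bij_betw_finite[OF last_nbrs[OF True]] by simp
next
  case False
  then have "nbrs x = {}"
    by (auto simp: nbrs_iff)
  then show ?thesis
    by simp
qed

lemma dist_nbrs:
  "y \<in> nbrs x \<Longrightarrow> tree_dist w x = tree_dist w y + 1 \<or> tree_dist w y = tree_dist w x + 1"
  unfolding nbrs_iff using tree_dist_snoc[of x _ w] tree_dist_snoc[of y _ w] by blast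

text \<open>This expresses that the cover has no cycles. A proper prefix of \<open>w\<close> has its
  parent one letter further along \<open>w\<close>; any other word has its parent one letter
  shorter.\<close>

lemma unique_parent:
  assumes "x \<in> CV" "x \<noteq> w"
  shows "\<exists>!y. y \<in> nbrs x \<and> tree_dist w x = tree_dist w y + 1"
proof (cases "prefix x w")
  case True
  then obtain a zs where a: "w = (x @ [a]) @ zs"
    using assms by (metis append.assoc append_Cons append_Nil append_Nil2 neq_Nil_conv prefix_def)
  then have p: "prefix (x @ [a]) w"
    by auto
  have "x @ [a] \<in> CV"
    using w a nonbacktracking_append[of "x @ [a]" zs] CV_nonempty[OF assms(1)]
    by (auto simp: cover_verts_def walk_def successively_append_iff)
  show ?thesis
  proof (rule ex1I)
    show "x @ [a] \<in> nbrs x \<and> tree_dist w x = tree_dist w (x @ [a]) + 1"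
      using \<open>x @ [a] \<in> CV\<close> assms tree_dist_snoc(1)[OF p] by (auto simp: nbrs_iff)
    fix y assume y: "y \<in> nbrs x \<and> tree_dist w x = tree_dist w y + 1"
    then consider b where "y = x @ [b]" | b where "x = y @ [b]"
      by (auto simp: nbrs_iff)
    then show "y = x @ [a]"
    proof cases
      case 1
      then have "prefix (x @ [b]) w"
        using y tree_dist_snoc(2)[of x b w] by fastforce
      then show ?thesis
        using 1 a by (auto simp: prefix_def)
    next
      case 2
      then show ?thesis
        using True y tree_dist_snoc(1)[of y b w] by simp
    qed
  qed
next
  case False
  obtain y b where x: "x = y @ [b]"
    using CV_nonempty assms by (metis rev_exhaust)
  \<comment> \<open>Cover words start at \<open>x0\<close>, so a one-letter word would be a prefix
    of \<open>w\<close>.\<close>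
  have "y \<noteq> []"
  proof
    assume "y = []"
    then have "x = [hd w]"
      using x assms w singleton_CV by (auto simp: cover_verts_def)
    then have "prefix x w"
      using CV_nonempty[OF w] by (cases w) auto
    then show False
      using False by simp
  qed
  then have y: "y \<in> CV"
    using snoc_CV_D assms x by auto
  show ?thesis
  proof (rule ex1I)
    show "y \<in> nbrs x \<and> tree_dist w x = tree_dist w y + 1"
      using y x False assms tree_dist_snoc(2)[of y b w] by (auto simp: nbrs_iff)
    fix z assume z: "z \<in> nbrs x \<and> tree_dist w x = tree_dist w z + 1"
    have "\<not> prefix (x @ [c]) w" for c
      using False by (auto dest: append_prefixD)
    then have "z \<noteq> x @ [c]" for c
      using z tree_dist_snoc(2)[of x c w] by auto
    then show "z = y"
      using z x by (auto simp: nbrs_iff)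
  qed
qed

lemma graph_dist_cover: "x \<in> CV \<Longrightarrow> graph_dist CV CE x w = tree_dist w x"
proof (rule graph_dist_eqI)
  show "tree_dist w x \<le> tree_dist w y + 1" if "{x, y} \<in> CE" for x y
    using dist_nbrs[of y x] that by (auto simp: nbrs_def)
  show "\<exists>y\<in>CV. {x, y} \<in> CE \<and> tree_dist w x = tree_dist w y + 1"
    if x: "x \<in> CV" and pos: "0 < tree_dist w x" for x
  proof -
    have "x \<noteq> w"
      using pos tree_dist_eq_0_iff[of w x] by simp
    then obtain y where y: "y \<in> nbrs x" "tree_dist w x = tree_dist w y + 1"
      using unique_parent[OF x] by blast
    then have "y \<in> CV"
      by (simp add: nbrs_iff)
    then show ?thesis
      using y by (auto simp: nbrs_def)
  qed
qed (auto simp: tree_dist_eq_0_iff w)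

text \<open>The edges of the sphere, oriented away from \<open>w\<close>. Neighbours never have
  equal distance to \<open>w\<close>, so each edge has exactly one such orientation.\<close>

definition arcs :: "nat \<Rightarrow> ('a list \<times> 'a list) set" where
  "arcs r = {(x, y). y \<in> nbrs x \<and> tree_dist w x = r \<and> tree_dist w y = r + 1}"

lemma arcsD:
  assumes "(x, y) \<in> arcs r"
  shows "y \<in> CV" "y \<noteq> w" "x \<in> nbrs y" "tree_dist w y = tree_dist w x + 1"
    "tree_dist w y = Suc r"
proof -
  have y: "y \<in> nbrs x" "tree_dist w x = r" "tree_dist w y = r + 1"
    using assms by (auto simp: arcs_def)
  then show "x \<in> nbrs y"
    by (simp add: nbrs_sym[of x y])
  then show "y \<in> CV"
    by (simp add: nbrs_iff)
  show "y \<noteq> w"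
    using y tree_dist_eq_0_iff[of w y] by auto
qed (use assms in \<open>auto simp: arcs_def\<close>)

lemma cover_sphere_eq: "cover_sphere V E x0 w r = (\<lambda>(x, y). {x, y}) ` arcs r"
proof (intro set_eqI iffI)
  fix e assume "e \<in> cover_sphere V E x0 w r"
  then obtain x y where e: "e = {x, y}" "e \<in> CE"
    and m: "min (graph_dist CV CE x w) (graph_dist CV CE y w) = r"
    unfolding cover_sphere_def edge_sphere_def by blast
  then have n: "y \<in> nbrs x"
    by (simp add: nbrs_def)
  then have "min (tree_dist w x) (tree_dist w y) = r"
    using m graph_dist_cover by (simp add: nbrs_iff)
  then have "(x, y) \<in> arcs r \<or> (y, x) \<in> arcs r"
    using dist_nbrs[OF n] n nbrs_sym by (auto simp: arcs_def)
  then show "e \<in> (\<lambda>(x, y). {x, y}) ` arcs r"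
  proof
    assume "(x, y) \<in> arcs r"
    then show ?thesis
      using e(1) by (intro image_eqI[of _ _ "(x, y)"]) simp_all
  next
    assume "(y, x) \<in> arcs r"
    then show ?thesis
      using e(1) by (intro image_eqI[of _ _ "(y, x)"]) (simp_all add: insert_commute)
  qed
next
  fix e assume "e \<in> (\<lambda>(x, y). {x, y}) ` arcs r"
  then obtain x y where e: "e = {x, y}" "y \<in> nbrs x"
    and "tree_dist w x = r" "tree_dist w y = r + 1"
    by (auto simp: arcs_def)
  moreover from this have "min (graph_dist CV CE x w) (graph_dist CV CE y w) = r"
    using graph_dist_cover by (simp add: nbrs_iff)
  ultimately show "e \<in> cover_sphere V E x0 w r"
    unfolding cover_sphere_def edge_sphere_def nbrs_def by blast
qed

lemma inj_arcs: "inj_on (\<lambda>(x, y). {x, y}) (arcs r)"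
  by (auto simp: inj_on_def arcs_def doubleton_eq_iff)

text \<open>The unnormalised mean. For the constant function \<open>1\<close> it counts the edges of
  the sphere, so numerator and denominator obey one recursion.\<close>

definition arc_sum :: "('a set \<Rightarrow> real) \<Rightarrow> nat \<Rightarrow> real" where
  "arc_sum f r = (\<Sum>(x, y)\<in>arcs r. f {last x, last y})"

lemma spherical_mean_eq: "spherical_mean V E x0 f w r = arc_sum f r / arc_sum (\<lambda>_. 1) r"
proof -
  have "(\<Sum>e\<in>cover_sphere V E x0 w r. lift g e) = arc_sum g r" for g
    unfolding cover_sphere_eq arc_sum_def
    by (subst sum.reindex[OF inj_arcs]) (auto simp: lift_def intro!: sum.cong)
  moreover have "real (card (cover_sphere V E x0 w r)) = arc_sum (\<lambda>_. 1) r"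
    unfolding cover_sphere_eq card_image[OF inj_arcs] arc_sum_def by (simp add: case_prod_unfold)
  ultimately show ?thesis
    by (simp add: spherical_mean_def)
qed

lemma arcs_0: "arcs 0 = Pair w ` nbrs w"
proof -
  have "tree_dist w w = 0"
    by (simp add: tree_dist_eq_0_iff)
  then have "tree_dist w y = 1" if "y \<in> nbrs w" for y
    using dist_nbrs[OF that] by simp
  then show ?thesis
    by (auto simp: arcs_def tree_dist_eq_0_iff)
qed

text \<open>An arc at the next radius starts at some \<open>y \<noteq> w\<close>, entered by the arc
  from its parent. Conversely every neighbour of \<open>y\<close> other than the parent lies farther
  out.\<close>

lemma arcs_Suc:
  "arcs (Suc r) = (\<lambda>((x, y), z). (y, z)) ` (SIGMA (x, y):arcs r. nbrs y - {x})"
proof (intro set_eqI iffI)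
  fix a assume "a \<in> arcs (Suc r)"
  then obtain y z where a: "a = (y, z)" "z \<in> nbrs y"
    "tree_dist w y = Suc r" "tree_dist w z = Suc r + 1"
    by (auto simp: arcs_def)
  then have "y \<in> CV" "y \<noteq> w"
    using tree_dist_eq_0_iff[of w y] by (auto simp: nbrs_iff)
  then obtain x where x: "x \<in> nbrs y" "tree_dist w y = tree_dist w x + 1"
    using unique_parent by blast
  then have "(x, y) \<in> arcs r" "z \<in> nbrs y - {x}"
    using a nbrs_sym[of x y] by (auto simp: arcs_def)
  then show "a \<in> (\<lambda>((x, y), z). (y, z)) ` (SIGMA (x, y):arcs r. nbrs y - {x})"
    using a(1) by (intro image_eqI[of _ _ "((x, y), z)"]) simp_all
next
  fix a assume "a \<in> (\<lambda>((x, y), z). (y, z)) ` (SIGMA (x, y):arcs r. nbrs y - {x})"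
  then obtain x y z where a: "a = (y, z)" "(x, y) \<in> arcs r" "z \<in> nbrs y" "z \<noteq> x"
    by auto
  note y = arcsD[OF a(2)]
  have "tree_dist w y \<noteq> tree_dist w z + 1"
    using unique_parent[OF y(1,2)] y(3,4) a by blast
  then have "tree_dist w z = tree_dist w y + 1"
    using dist_nbrs[OF a(3)] by blast
  then show "a \<in> arcs (Suc r)"
    using a y(5) by (simp add: arcs_def)
qed

text \<open>Forgetting \<open>x\<close> loses nothing, because \<open>x\<close> is the unique parent
  of \<open>y\<close>.\<close>

lemma inj_arcs_Suc:
  "inj_on (\<lambda>((x, y), z). (y, z)) (SIGMA (x, y):arcs r. nbrs y - {x})"
proof -
  have "x = x'" if "(x, y) \<in> arcs r" "(x', y) \<in> arcs r" for x x' y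
    using unique_parent[OF arcsD(1,2)[OF that(1)]] arcsD(3,4)[OF that(1)] arcsD(3,4)[OF that(2)]
    by blast
  then show ?thesis
    by (auto simp: inj_on_def)
qed

lemma finite_arcs: "finite (arcs r)"
proof (induction r)
  case (Suc r)
  then have "finite (SIGMA (x, y):arcs r. nbrs y - {x})"
    using finite_nbrs by (intro finite_SigmaI) auto
  then show ?case
    unfolding arcs_Suc by (rule finite_imageI)
qed (simp add: arcs_0 finite_nbrs)

lemma sum_nbrs:
  assumes "x \<in> CV"
  shows "(\<Sum>y\<in>nbrs x. f {last x, last y}) = sum f (star E (last x))"
proof -
  have "star E (last x) = (\<lambda>u. {last x, u}) ` {u. {last x, u} \<in> E}"
  proof (intro set_eqI iffI)
    fix e assume e: "e \<in> star E (last x)"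
    then have "card e = 2" "last x \<in> e" "e \<in> E"
      using simple by (auto simp: star_def simple_graph_def)
    then obtain u where "e = {last x, u}"
      by (auto simp: card_2_iff insert_commute)
    then show "e \<in> (\<lambda>u. {last x, u}) ` {u. {last x, u} \<in> E}"
      using \<open>e \<in> E\<close> by blast
  qed (auto simp: star_def)
  moreover have "inj_on (\<lambda>u. {last x, u}) {u. {last x, u} \<in> E}"
    by (auto simp: inj_on_def doubleton_eq_iff)
  ultimately have "sum f (star E (last x)) = (\<Sum>u\<in>{u. {last x, u} \<in> E}. f {last x, u})"
    by (simp add: sum.reindex)
  also have "\<dots> = (\<Sum>y\<in>nbrs x. f {last x, last y})"
    using sum.reindex_bij_betw[OF last_nbrs[OF assms], of "\<lambda>u. f {last x, u}"] by simp
  finally show ?thesis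
    by simp
qed

lemma arc_sum_0: "arc_sum f 0 = sum f (star E (last w))"
  by (simp add: arc_sum_def arcs_0 sum.reindex inj_on_def sum_nbrs w)

text \<open>Arcs are grouped by their predecessor: those continuing \<open>(x, y)\<close> project to
  the star at \<open>last y\<close> without the edge just traversed.\<close>

lemma arc_sum_Suc:
  "arc_sum f (Suc r) = (\<Sum>(x, y)\<in>arcs r. sum f (star E (last y)) - f {last x, last y})"
proof -
  have "arc_sum f (Suc r) = (\<Sum>((x, y), z)\<in>(SIGMA (x, y):arcs r. nbrs y - {x}). f {last y, last z})"
    unfolding arc_sum_def arcs_Suc by (subst sum.reindex[OF inj_arcs_Suc]) (auto intro!: sum.cong)
  also have "\<dots> = (\<Sum>(x, y)\<in>arcs r. \<Sum>z\<in>nbrs y - {x}. f {last y, last z})"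
    using sum.Sigma[of "arcs r" "\<lambda>(x, y). nbrs y - {x}" "\<lambda>(x, y) z. f {last y, last z}"]
      finite_arcs finite_nbrs by (simp add: case_prod_unfold)
  also have "\<dots> = (\<Sum>(x, y)\<in>arcs r. sum f (star E (last y)) - f {last x, last y})"
  proof (intro sum.cong refl, clarify)
    fix x y assume "(x, y) \<in> arcs r"
    then have "y \<in> CV" "x \<in> nbrs y"
      by (fact arcsD)+
    then show "(\<Sum>z\<in>nbrs y - {x}. f {last y, last z})
        = sum f (star E (last y)) - f {last x, last y}"
      using sum_nbrs[of y f] by (simp add: sum_diff1 finite_nbrs insert_commute)
  qed
  finally show ?thesis .
qed

end

section \<open>Decay of the spherical means\<close>

text \<open>Placing the projected basepoint in \<open>A\<close> fixes which operator acts at which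
  radius. A basepoint over \<open>B\<close> is treated by exchanging the sides.\<close>

locale semiregular_cover = semiregular_graph V E A B p q + cover V E x0 w
  for V :: "'a set" and E A B p q x0 w +
  assumes last_w: "last w \<in> A"
begin

interpretation A: edge_side E A p by (rule side_A)
interpretation B: edge_side E B q by (rule side_B)

text \<open>Each edge changes sides, and the arcs of radius \<open>0\<close> start over
  \<open>A\<close>.\<close>

lemma arcs_alternate:
  assumes "(x, y) \<in> arcs r"
  shows "if even r then last y \<in> B else last y \<in> A"
  using assms
proof (induction r arbitrary: x y)
  case 0
  then have "{last w, last y} \<in> E"
    using nbrs_edge by (auto simp: arcs_0)
  then show ?case
    using bip[of "{last w, last y}"] last_w disj by (auto simp: doubleton_eq_iff)
next
  case (Suc r)
  then obtain z where z: "(z, x) \<in> arcs r" "y \<in> nbrs x"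
    by (auto simp: arcs_Suc)
  then have "{last x, last y} \<in> E"
    using nbrs_edge by blast
  then show ?case
    using bip[of "{last x, last y}"] Suc.IH[OF z(1)] disj
    by (auto simp: doubleton_eq_iff split: if_splits)
qed

lemma arc_edge: "(x, y) \<in> arcs r \<Longrightarrow> {last x, last y} \<in> E"
  using nbrs_edge by (auto simp: arcs_def)

lemma arc_sum_step:
  "arc_sum f (Suc r) = (if even r then q * arc_sum (edge_mean E B q f) r
     else p * arc_sum (edge_mean E A p f) r)"
proof (cases "even r")
  case True
  have "sum f (star E (last y)) - f {last x, last y} = q * edge_mean E B q f {last x, last y}"
    if "(x, y) \<in> arcs r" for x y
    using arcs_alternate[OF that] arc_edge[OF that] True q2
      B.edge_mean_star[of "last y" "{last x, last y}" f] by (auto simp: star_def)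
  then show ?thesis
    unfolding arc_sum_Suc unfolding arc_sum_def
    using True by (auto simp: sum_distrib_left intro!: sum.cong)
next
  case False
  have "sum f (star E (last y)) - f {last x, last y} = p * edge_mean E A p f {last x, last y}"
    if "(x, y) \<in> arcs r" for x y
    using arcs_alternate[OF that] arc_edge[OF that] False p2
      A.edge_mean_star[of "last y" "{last x, last y}" f] by (auto simp: star_def)
  then show ?thesis
    unfolding arc_sum_Suc unfolding arc_sum_def
    using False by (auto simp: sum_distrib_left intro!: sum.cong)
qed

lemma arc_sum_cong:
  assumes "\<And>e. e \<in> E \<Longrightarrow> f e = g e"
  shows "arc_sum f r = arc_sum g r"
  unfolding arc_sum_def using assms arc_edge by (intro sum.cong) auto

lemma arc_sum_one_Suc: "arc_sum (\<lambda>_. 1) (Suc r) = (if even r then q else p) * arc_sum (\<lambda>_. 1) r"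
  using arc_sum_cong[OF A.edge_mean_one] arc_sum_cong[OF B.edge_mean_one]
  by (simp add: arc_sum_step)

lemma arc_sum_one_pos: "0 < arc_sum (\<lambda>_. 1) r"
proof (induction r)
  case 0
  then show ?case
    using degA[OF last_w] by (simp add: arc_sum_0)
next
  case (Suc r)
  then show ?case
    using p2 q2 by (simp add: arc_sum_one_Suc)
qed

abbreviation "M \<equiv> \<lambda>f r. spherical_mean V E x0 f w r"

lemma mean_0: "M f 0 = sum f (star E (last w)) / (p + 1)"
  using degA[OF last_w] by (simp add: spherical_mean_eq arc_sum_0)

text \<open>Passing from radius \<open>r\<close> to \<open>r + 1\<close> multiplies sum and count by
  the same factor \<open>p\<close> or \<open>q\<close>, which cancels. The operator of the outermost
  radius is applied to \<open>f\<close> first.\<close>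

lemma mean_Suc:
  "M f (Suc r) = M (if even r then edge_mean E B q f else edge_mean E A p f) r"
  using p2 q2 by (simp add: spherical_mean_eq arc_sum_step[of f] arc_sum_one_Suc)

lemma mean_diff_const: "M (\<lambda>e. f e - c) r = M f r - c"
proof -
  have "arc_sum (\<lambda>e. f e - c) r = arc_sum f r - c * arc_sum (\<lambda>_. 1) r"
    by (simp add: arc_sum_def case_prod_unfold sum_subtractf mult.commute)
  then show ?thesis
    using arc_sum_one_pos[of r] by (simp add: spherical_mean_eq field_simps)
qed

lemma mean_0_le: "\<bar>M f 0\<bar> \<le> L2_set f E"
proof -
  have "\<bar>f e\<bar> \<le> L2_set f E" if "e \<in> E" for e
  proof -
    have "(f e)\<^sup>2 \<le> (\<Sum>e\<in>E. (f e)\<^sup>2)"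
      using that fin_E by (intro member_le_sum) auto
    then have "sqrt ((f e)\<^sup>2) \<le> L2_set f E"
      unfolding L2_set_def by (rule real_sqrt_le_mono)
    then show ?thesis
      by simp
  qed
  then have "\<bar>sum f (star E (last w))\<bar> \<le> (\<Sum>e\<in>star E (last w). L2_set f E)"
    using A.star_subset by (intro order_trans[OF sum_abs] sum_mono) auto
  then show ?thesis
    using degA[OF last_w] by (simp add: mean_0 field_simps)
qed

text \<open>Radii are removed two at a time, each pair gaining a factor \<open>\<rho>\<close>. A
  leftover single step does not increase the norm. Both orders of composition occur, according to
  the parity of \<open>r\<close>.\<close>

lemma mean_le:
  assumes \<rho>: "0 \<le> \<rho>"
    and AB: "\<And>f. sum f E = 0 \<Longrightarrow>
      L2_set (edge_mean E B q (edge_mean E A p f)) E \<le> \<rho> * L2_set f E"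
    and BA: "\<And>f. sum f E = 0 \<Longrightarrow>
      L2_set (edge_mean E A p (edge_mean E B q f)) E \<le> \<rho> * L2_set f E"
    and "sum f E = 0"
  shows "\<bar>M f r\<bar> \<le> L2_set f E * \<rho> ^ (r div 2)"
  using \<open>sum f E = 0\<close>
proof (induction r arbitrary: f rule: induct_nat_012)
  case 0
  then show ?case
    using mean_0_le by simp
next
  case 1
  have "L2_set (edge_mean E B q f) E \<le> L2_set f E"
    unfolding L2_set_def by (intro real_sqrt_le_mono B.edge_mean_norm_le)
  then show ?case
    using mean_0_le[of "edge_mean E B q f"] by (simp add: mean_Suc)
next
  case (ge2 r)
  define g where "g = (if even r then edge_mean E B q (edge_mean E A p f)
    else edge_mean E A p (edge_mean E B q f))"
  have "M f (Suc (Suc r)) = M g r"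
    by (simp add: mean_Suc g_def)
  also have "\<bar>M g r\<bar> \<le> L2_set g E * \<rho> ^ (r div 2)"
    using ge2 by (intro ge2.IH) (simp add: g_def A.sum_edge_mean B.sum_edge_mean)
  also have "\<dots> \<le> \<rho> * L2_set f E * \<rho> ^ (r div 2)"
    using AB[OF ge2.prems] BA[OF ge2.prems] \<rho>
    by (intro mult_right_mono) (auto simp: g_def)
  finally show ?case
    by (simp add: mult_ac)
qed

lemma mean_deviation:
  assumes \<rho>: "0 \<le> \<rho>"
    and AB: "\<And>f. sum f E = 0 \<Longrightarrow>
      L2_set (edge_mean E B q (edge_mean E A p f)) E \<le> \<rho> * L2_set f E"
    and BA: "\<And>f. sum f E = 0 \<Longrightarrow>
      L2_set (edge_mean E A p (edge_mean E B q f)) E \<le> \<rho> * L2_set f E"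
  shows "\<bar>M f r - sum f E / card E\<bar> \<le> L2_set f E * \<rho> ^ (r div 2)"
proof -
  define c where "c = sum f E / card E"
  define g where "g = (\<lambda>e. f e - c)"
  have n: "0 < real (card E)"
    using fin_E E_ne by (simp add: card_gt_0_iff)
  then have g0: "sum g E = 0"
    by (simp add: g_def sum_subtractf c_def)
  \<comment> \<open>Pythagoras: subtracting the mean is an orthogonal projection, so it does not
    increase the norm.\<close>
  have "(\<Sum>e\<in>E. (f e)\<^sup>2) = (\<Sum>e\<in>E. (g e)\<^sup>2 + 2 * c * g e + c\<^sup>2)"
    by (intro sum.cong) (auto simp: g_def power2_eq_square algebra_simps)
  also have "\<dots> = (\<Sum>e\<in>E. (g e)\<^sup>2) + card E * c\<^sup>2"
    using g0 by (simp add: sum.distrib sum_distrib_left[symmetric])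
  finally have "L2_set g E \<le> L2_set f E"
    unfolding L2_set_def by (intro real_sqrt_le_mono) simp
  moreover have "\<bar>M g r\<bar> \<le> L2_set g E * \<rho> ^ (r div 2)"
    using mean_le[OF \<rho> AB BA g0] .
  moreover have "M g r = M f r - c"
    unfolding g_def by (rule mean_diff_const)
  ultimately show ?thesis
    using \<rho> mult_right_mono[of "L2_set g E" "L2_set f E" "\<rho> ^ (r div 2)"]
    by (auto simp: c_def)
qed

end

text \<open>The reverse order comes from \<open>swap\<close>. Taking the larger of the two factors
  gives one \<open>\<rho>\<close> for both, and the square root passes from squared norms to
  norms.\<close>

lemma (in semiregular_graph) two_step_contraction_L2:
  obtains \<rho> :: real where "0 \<le> \<rho>" "\<rho> < 1"
    "\<And>f. sum f E = 0 \<Longrightarrow> L2_set (edge_mean E B q (edge_mean E A p f)) E \<le> \<rho> * L2_set f E"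
    "\<And>f. sum f E = 0 \<Longrightarrow> L2_set (edge_mean E A p (edge_mean E B q f)) E \<le> \<rho> * L2_set f E"
proof -
  obtain \<gamma> where \<gamma>: "0 \<le> \<gamma>" "\<gamma> < 1" "\<And>f. sum f E = 0 \<Longrightarrow>
       (\<Sum>e\<in>E. (edge_mean E B q (edge_mean E A p f) e)\<^sup>2) \<le> \<gamma> * (\<Sum>e\<in>E. (f e)\<^sup>2)"
    using two_step_contraction by blast
  obtain \<gamma>' where \<gamma>': "0 \<le> \<gamma>'" "\<gamma>' < 1" "\<And>f. sum f E = 0 \<Longrightarrow>
       (\<Sum>e\<in>E. (edge_mean E A p (edge_mean E B q f) e)\<^sup>2) \<le> \<gamma>' * (\<Sum>e\<in>E. (f e)\<^sup>2)"
    using semiregular_graph.two_step_contraction[OF swap] by blast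
  have root: "L2_set g E \<le> sqrt (max \<gamma> \<gamma>') * L2_set f E"
    if "(\<Sum>e\<in>E. (g e)\<^sup>2) \<le> c * (\<Sum>e\<in>E. (f e)\<^sup>2)" "c \<le> max \<gamma> \<gamma>'" for f g c
  proof -
    have "c * (\<Sum>e\<in>E. (f e)\<^sup>2) \<le> max \<gamma> \<gamma>' * (\<Sum>e\<in>E. (f e)\<^sup>2)"
      using that by (intro mult_right_mono sum_nonneg) auto
    then show ?thesis
      using that unfolding L2_set_def real_sqrt_mult[symmetric] by (intro real_sqrt_le_mono) simp
  qed
  show ?thesis
    using \<gamma> \<gamma>' by (intro that[of "sqrt (max \<gamma> \<gamma>')"] root[OF \<gamma>(3)] root[OF \<gamma>'(3)]) auto
qed

section \<open>From the hypotheses on the graph to sides with known degrees\<close>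

lemma star_nonempty:
  assumes "connected_graph V E" "simple_graph V E" "E \<noteq> {}" "v \<in> V"
  shows "star E v \<noteq> {}"
proof -
  obtain e where e: "e \<in> E" "e \<subseteq> V" "card e = 2"
    using assms by (auto simp: simple_graph_def)
  then obtain u where u: "u \<in> e" "u \<noteq> v"
    by (auto simp: card_2_iff)
  then obtain xs where xs: "walk V E xs" "hd xs = v" "last xs = u"
    using assms e unfolding connected_graph_def by blast
  \<comment> \<open>A walk from \<open>v\<close> to the different vertex \<open>u\<close> has a
    first edge, and this edge contains \<open>v\<close>.\<close>
  then obtain b ys where "xs = v # b # ys"
    using u by (cases xs rule: remdups_adj.cases) (auto simp: walk_def)
  then have "{v, b} \<in> E"
    using xs by (simp add: walk_def)
  then show ?thesis
    by (auto simp: star_def)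
qed

text \<open>The definition of semiregularity does not say which class of the bipartition carries
  which degree. If \<open>p = q\<close>, any bipartition serves; otherwise the degrees themselves
  define the sides.\<close>

lemma semiregular_sides:
  assumes "2 \<le> p" "2 \<le> q" "finite V" "simple_graph V E" "semiregular p q V E" "E \<noteq> {}"
  obtains A B where "semiregular_graph V E A B p q"
proof -
  have conn: "connected_graph V E"
    and deg: "\<And>e. e \<in> E \<Longrightarrow> \<exists>x y. e = {x, y} \<and> card (star E x) = p + 1 \<and> card (star E y) = q + 1"
    using assms by (auto simp: semiregular_def vertex_degree_def star_def)
  have sub: "e \<subseteq> V" if "e \<in> E" for e
    using that assms by (auto simp: simple_graph_def)
  have deg': "card (star E v) = p + 1 \<or> card (star E v) = q + 1" if v: "v \<in> V" for v
  proof -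
    obtain e where "e \<in> E" "v \<in> e"
      using star_nonempty[OF conn assms(4,6) v] by (auto simp: star_def)
    then show ?thesis
      using deg[of e] by auto
  qed
  show ?thesis
  proof (cases "p = q")
    case True
    obtain A B where AB: "A \<union> B = V" "A \<inter> B = {}" "\<forall>e\<in>E. \<exists>a\<in>A. \<exists>b\<in>B. e = {a, b}"
      using assms by (auto simp: semiregular_def bipartite_graph_def)
    have "semiregular_graph V E A B p q"
      by unfold_locales (use AB conn assms deg' True in auto)
    then show ?thesis
      by (rule that)
  next
    case False
    define A where "A = {v \<in> V. card (star E v) = p + 1}"
    define B where "B = {v \<in> V. card (star E v) = q + 1}"
    have "semiregular_graph V E A B p q"
    proof
      show "\<exists>a\<in>A. \<exists>b\<in>B. e = {a, b}" if "e \<in> E" for e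
        using deg[OF that] sub[OF that] by (auto simp: A_def B_def)
      show "V = A \<union> B"
        using deg' by (auto simp: A_def B_def)
    qed (use conn assms False in \<open>auto simp: A_def B_def\<close>)
    then show ?thesis
      by (rule that)
  qed
qed

text \<open>A single vertex without edges satisfies the hypotheses of the theorem. All spheres are
  then empty, and division by zero gives \<open>0\<close> for both averages.\<close>

lemma spherical_mean_no_edges: "spherical_mean V {} x0 f v r = 0"
proof -
  have "xs @ [y] \<in> cover_verts V {} x0 \<Longrightarrow> xs = []" for xs y
    by (auto simp: cover_verts_def walk_def successively_append_iff)
  then have "cover_edges V {} x0 = {}"
    by (fastforce simp: cover_edges_def cover_verts_def walk_def)
  then show ?thesis
    by (simp add: spherical_mean_def cover_sphere_def edge_sphere_def)
qed

section \<open>Choice of constants and uniformity in the basepoint\<close>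

theorem theorem3:
  fixes V :: "'a set" and E :: "'a set set" and p q :: nat
  assumes "2 \<le> p" and "2 \<le> q"
    and "finite V" and "simple_graph V E" and "semiregular p q V E"
  shows "\<exists>C \<beta> :: real. 0 < C \<and> real (p * q) powr (- 1 / 4) \<le> \<beta> \<and> \<beta> < 1 \<and>
    (\<forall>x0\<in>V. \<forall>f :: 'a set \<Rightarrow> real. \<forall>v0\<in>cover_verts V E x0. \<forall>r :: nat.
       \<bar>spherical_mean V E x0 f v0 r - (\<Sum>e\<in>E. f e) / real (card E)\<bar>
         \<le> C * L2_set f E * \<beta> ^ r)"
proof -
  define \<beta>0 where "\<beta>0 = real (p * q) powr (- 1 / 4)"
  have "1 < p * q"
    using assms by (metis less_1_mult less_le_trans one_less_numeral_iff semiring_norm(76))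
  then have "1 < real (p * q)"
    by (metis of_nat_1 of_nat_less_iff)
  then have \<beta>0: "0 < \<beta>0" "\<beta>0 < 1"
    using powr_less_one[of "real (p * q)" "- 1 / 4"] assms(1,2) unfolding \<beta>0_def by auto
  show ?thesis
  proof (cases "E = {}")
    case True
    then show ?thesis
      using \<beta>0 unfolding \<beta>0_def[symmetric]
      by (intro exI[of _ 1] exI[of _ \<beta>0]) (simp add: spherical_mean_no_edges)
  next
    case False
    then obtain A B where "semiregular_graph V E A B p q"
      using semiregular_sides assms by metis
    then interpret semiregular_graph V E A B p q .
    obtain \<rho> where \<rho>: "0 \<le> \<rho>" "\<rho> < 1"
      and AB: "\<And>f. sum f E = 0 \<Longrightarrow>
        L2_set (edge_mean E B q (edge_mean E A p f)) E \<le> \<rho> * L2_set f E"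
      and BA: "\<And>f. sum f E = 0 \<Longrightarrow>
        L2_set (edge_mean E A p (edge_mean E B q f)) E \<le> \<rho> * L2_set f E"
      using two_step_contraction_L2 by blast
    \<comment> \<open>The square root appears because \<open>\<rho>\<close> is gained once per two
      steps; the maximum enforces the required lower bound and keeps \<open>\<beta>\<close>
      positive.\<close>
    define \<beta> where "\<beta> = max \<beta>0 (sqrt \<rho>)"
    have \<beta>: "0 < \<beta>" "\<beta>0 \<le> \<beta>" "\<beta> < 1"
      using \<beta>0 \<rho> by (auto simp: \<beta>_def)
    have "\<rho> \<le> \<beta>\<^sup>2"
      using \<rho> real_sqrt_le_iff[of \<rho> "\<beta>\<^sup>2"] \<beta> by (simp add: \<beta>_def)
    have pow: "\<rho> ^ (r div 2) \<le> 1 / \<beta> * \<beta> ^ r" for r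
    proof -
      have "\<rho> ^ (r div 2) \<le> \<beta> ^ (2 * (r div 2))"
        using power_mono[OF \<open>\<rho> \<le> \<beta>\<^sup>2\<close> \<rho>(1)] by (simp add: power_mult)
      then have "\<rho> ^ (r div 2) * \<beta> \<le> \<beta> ^ (2 * (r div 2)) * \<beta>"
        using \<beta> by (intro mult_right_mono) auto
      also have "\<dots> = \<beta> ^ Suc (2 * (r div 2))"
        by simp
      \<comment> \<open>\<open>r\<close> exceeds \<open>2 * (r div 2)\<close> by at most one. This
        possible odd step costs one factor \<open>\<beta>\<close>, hence the constant
        \<open>1 / \<beta>\<close>.\<close>
      also have "\<dots> \<le> \<beta> ^ r"
      proof (rule power_decreasing)
        show "r \<le> Suc (2 * (r div 2))"
          by presburger
      qed (use \<beta> in auto)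
      finally show ?thesis
        using \<beta> by (simp add: field_simps)
    qed
    have "\<bar>spherical_mean V E x0 f v0 r - sum f E / real (card E)\<bar> \<le> 1 / \<beta> * L2_set f E * \<beta> ^ r"
      if "x0 \<in> V" "v0 \<in> cover_verts V E x0" for x0 f v0 r
    proof -
      have cov: "cover V E x0 v0"
        using that assms fin_E by unfold_locales auto
      have "last v0 \<in> V"
        using that last_in_set by (auto simp: cover_verts_def walk_def)
      \<comment> \<open>\<open>\<rho>\<close> bounds both orders of composition, so the same
        constants serve basepoints over either side.\<close>
      then consider "last v0 \<in> A" | "last v0 \<in> B"
        using V_eq by blast
      then have "\<bar>spherical_mean V E x0 f v0 r - sum f E / real (card E)\<bar>
          \<le> L2_set f E * \<rho> ^ (r div 2)"
      proof cases
        case 1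
        then interpret semiregular_cover V E A B p q x0 v0
          using cov by (intro semiregular_cover.intro semiregular_cover_axioms.intro)
            (rule semiregular_graph_axioms)
        show ?thesis
          using mean_deviation[OF \<rho>(1) AB BA] .
      next
        case 2
        then interpret semiregular_cover V E B A q p x0 v0
          using cov by (intro semiregular_cover.intro semiregular_cover_axioms.intro) (rule swap)
        show ?thesis
          using mean_deviation[OF \<rho>(1) BA AB] .
      qed
      also have "\<dots> \<le> L2_set f E * (1 / \<beta> * \<beta> ^ r)"
        by (intro mult_left_mono pow L2_set_nonneg)
      finally show ?thesis
        by (simp add: mult_ac)
    qed
    then show ?thesis
      using \<beta> unfolding \<beta>0_def[symmetric]
      by (intro exI[of _ "1 / \<beta>"] exI[of _ \<beta>]) auto
  qed
qed

end
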